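(* Let $\mathcal{H}$ be a real Hilbert space, $C \subseteq \mathcal{H}$ a nonempty closed convex set, and $f = f_1 + f_2$ where $f_1, f_2 : \mathcal{H} \times \mathcal{H} \to \mathbb{R} \cup \{+\infty\}$ are finite on $C \times C$ and satisfy $f_1(x,x) = f_2(x,x) = 0$ for every $x \in C$. Consider the equilibrium problem $(EP)$: find $x \in C$ such that $f(x,y) \ge 0$ for all $y \in C$, and suppose that its solution set $S(C,f)$ is nonempty. Assume: (A1) for each $i = 1,2$ and each $x \in C$, the function $f_i(x,\cdot)$ is convex and subdifferentiable, and for each $y \in C$ the function $f(\cdot, y)$ is weakly upper semicontinuous on $C$; (A2) if $\{x^k\} \subset C$ is a bounded sequence, then for each $i = 1,2$, every sequence $\{g_i^k\}$ with $g_i^k \in \partial_2 f_i(x^k, x^k)$ for all $k$ is bounded; (A3) $f$ is monotone on $C$. Suppose in addition that either $\operatorname{int} C \neq \emptyset$ or for each $x \in C$ both functions $f_1(x,\cdot)$ and $f_2(x,\cdot)$ are continuous at a point in $C$. Let $\{\beta_k\}_{k \ge 0}$ be a sequence of positive real numbers with $\sum_{k=0}^\infty \beta_k = +\infty$ and $\sum_{k=0}^\infty \beta_k^2 < +\infty$, and let $\{x^k\}$ be any sequence generated by the splitting algorithm: $x^0 \in C$ is arbitrary and, for $k = 0, 1, \ldots$, take any $g_1^k \in \partial_2 f_1(x^k,x^k)$ and $g_2^k \in \partial_2 f_2(x^k,x^k)$ and compute $$\eta_k := \max\{\beta_k, \|g_1^k\|, \|g_2^k\|\}, \qquad \lambda_k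 := \frac{\beta_k}{\eta_k},$$ $$y^k := \arg\min\left\{\lambda_k f_1(x^k,y) + \tfrac12 \|y - x^k\|^2 \;:\; y \in C\right\},$$ $$x^{k+1} := \arg\min\left\{\lambda_k f_2(x^k,y) + \tfrac12 \|y - y^k\|^2 \;:\; y \in C\right\}.$$ Define the ergodic sequence $$z^k := \frac{\sum_{i=0}^k \lambda_i x^i}{\sum_{i=0}^k \lambda_i}, \qquad k = 0,1,\ldots$$ Then $\{z^k\}$ converges weakly to a solution of $(EP)$.
   Context: $\langle\cdot,\cdot\rangle$ and $\|\cdot\|$ denote the inner product and norm of $\mathcal{H}$. For $x \in C$, $\partial_2 f_i(x,x)$ denotes the convex subdifferential of the function $f_i(x,\cdot)$ at the point $x$, i.e. the set of $g \in \mathcal{H}$ with $f_i(x,y) \ge f_i(x,x) + \langle g, y - x\rangle$ for all $y \in \mathcal{H}$. "Subdifferentiable" means that the convex subdifferential of $f_i(x,\cdot)$ is nonempty at each point of $C$. The bifunction $f$ is monotone on $C$ if $f(x,y) + f(y,x) \le 0$ for all $x,y \in C$. $S(C,f) := \{x \in C : f(x,y) \ge 0 \ \forall y \in C\}$ is the solution set of $(EP)$. *)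

theory Defs
  imports "HOL-Analysis.Analysis"
begin

(* The coarsest topology for which every continuous linear functional is continuous: the
   functions ('a \<Rightarrow>\<^sub>L real) \<Rightarrow> real carry the product topology. *)
definition weak_topology :: "'a::real_normed_vector topology" where
  "weak_topology = pullback_topology UNIV (\<lambda>x (\<phi> :: 'a \<Rightarrow>\<^sub>L real). blinfun_apply \<phi> x) euclidean"

definition weakly_usc_on :: "'a::real_normed_vector set \<Rightarrow> ('a \<Rightarrow> ereal) \<Rightarrow> bool" where
  "weakly_usc_on C h \<longleftrightarrow> (\<forall>a. openin (subtopology weak_topology C) {x \<in> C. h x < a})"

(* Meant for functions without the value -\<infinity>; recall that 0 * \<infinity> = 0 in ereal, so the
   cases t = 0 and t = 1 hold trivially. *)
definition ereal_convex :: "('a::real_vector \<Rightarrow> ereal) \<Rightarrow> bool" where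
  "ereal_convex h \<longleftrightarrow>
     (\<forall>x y. \<forall>t\<in>{0..1}. h ((1 - t) *\<^sub>R x + t *\<^sub>R y) \<le> ereal (1 - t) * h x + ereal t * h y)"

definition subdifferential :: "('a::real_inner \<Rightarrow> ereal) \<Rightarrow> 'a \<Rightarrow> 'a set" where
  "subdifferential h u = {g. \<forall>y. h u + ereal (g \<bullet> (y - u)) \<le> h y}"

definition subdifferentiable_on :: "'a::real_inner set \<Rightarrow> ('a \<Rightarrow> ereal) \<Rightarrow> bool" where
  "subdifferentiable_on C h \<longleftrightarrow> (\<forall>u\<in>C. subdifferential h u \<noteq> {})"

definition diag_subdifferential :: "('a::real_inner \<Rightarrow> 'a \<Rightarrow> ereal) \<Rightarrow> 'a \<Rightarrow> 'a set" where
  "diag_subdifferential f x = subdifferential (f x) x"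

definition diag_subdifferential_bounded_on ::
    "'a::real_inner set \<Rightarrow> ('a \<Rightarrow> 'a \<Rightarrow> ereal) \<Rightarrow> bool" where
  "diag_subdifferential_bounded_on C f \<longleftrightarrow>
     (\<forall>(x :: nat \<Rightarrow> 'a) g. range x \<subseteq> C \<longrightarrow> bounded (range x) \<longrightarrow>
        (\<forall>k. g k \<in> diag_subdifferential f (x k)) \<longrightarrow> bounded (range g))"

definition monotone_bifunction_on :: "'a set \<Rightarrow> ('a \<Rightarrow> 'a \<Rightarrow> ereal) \<Rightarrow> bool" where
  "monotone_bifunction_on C f \<longleftrightarrow> (\<forall>x\<in>C. \<forall>y\<in>C. f x y + f y x \<le> 0)"

definition EP_solutions :: "'a set \<Rightarrow> ('a \<Rightarrow> 'a \<Rightarrow> ereal) \<Rightarrow> 'a set" where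
  "EP_solutions C f = {x \<in> C. \<forall>y\<in>C. f x y \<ge> 0}"

definition prox_step :: "'a::real_inner set \<Rightarrow> real \<Rightarrow> ('a \<Rightarrow> ereal) \<Rightarrow> 'a \<Rightarrow> 'a \<Rightarrow> bool" where
  "prox_step C l h c u \<longleftrightarrow>
     is_arg_min (\<lambda>y. ereal l * h y + ereal (1 / 2 * (norm (y - c))\<^sup>2)) (\<lambda>y. y \<in> C) u"

definition step_size :: "real \<Rightarrow> 'a::real_inner \<Rightarrow> 'a \<Rightarrow> real" where
  "step_size \<beta> g1 g2 = \<beta> / max \<beta> (max (norm g1) (norm g2))"

definition splitting_iteration ::
    "'a::real_inner set \<Rightarrow> ('a \<Rightarrow> 'a \<Rightarrow> ereal) \<Rightarrow> ('a \<Rightarrow> 'a \<Rightarrow> ereal) \<Rightarrow> (nat \<Rightarrow> real) \<Rightarrow>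
     (nat \<Rightarrow> 'a) \<Rightarrow> (nat \<Rightarrow> 'a) \<Rightarrow> (nat \<Rightarrow> 'a) \<Rightarrow> (nat \<Rightarrow> 'a) \<Rightarrow> (nat \<Rightarrow> real) \<Rightarrow> bool" where
  "splitting_iteration C f1 f2 \<beta> x y g1 g2 l \<longleftrightarrow>
     x 0 \<in> C \<and>
     (\<forall>k. g1 k \<in> diag_subdifferential f1 (x k) \<and>
          g2 k \<in> diag_subdifferential f2 (x k) \<and>
          l k = step_size (\<beta> k) (g1 k) (g2 k) \<and>
          prox_step C (l k) (f1 (x k)) (x k) (y k) \<and>
          prox_step C (l k) (f2 (x k)) (y k) (x (Suc k)))"

definition ergodic_seq :: "(nat \<Rightarrow> real) \<Rightarrow> (nat \<Rightarrow> 'a::real_vector) \<Rightarrow> nat \<Rightarrow> 'a" where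
  "ergodic_seq l x k = (\<Sum>i\<le>k. l i *\<^sub>R x i) /\<^sub>R (\<Sum>i\<le>k. l i)"

end

theory Submission
  imports Defs
begin

text \<open>
  The optimality inequality of a proximal step, applied to both halves of an iteration and combined
  with the subgradient inequality at the diagonal point, gives for every \<open>v \<in> C\<close>
  \<open>\<parallel>x\<^sup>k\<^sup>+\<^sup>1 - v\<parallel>\<^sup>2 \<le> \<parallel>x\<^sup>k - v\<parallel>\<^sup>2 + 2 \<lambda>\<^sub>k f(x\<^sup>k, v) + 5 \<beta>\<^sub>k\<^sup>2\<close>
  (\<open>splitting_step_inequality\<close>). The normalisation by \<open>\<eta>\<^sub>k\<close> is what makes the error summable:
  it forces \<open>\<lambda>\<^sub>k \<parallel>g\<^sub>i\<^sup>k\<parallel> \<le> \<beta>\<^sub>k\<close>. The descent inequality is used twice.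

  For a solution \<open>v\<close>, monotonicity makes \<open>f(x\<^sup>k, v) \<le> 0\<close>, so \<open>\<parallel>x\<^sup>k - v\<parallel>\<close> converges. In particular the
  iterates are bounded; then the subgradients are bounded by hypothesis, \<open>\<lambda>\<^sub>k\<close> is at least a constant
  multiple of \<open>\<beta>\<^sub>k\<close>, and the weights \<open>\<lambda>\<^sub>k\<close> have infinite sum.

  For an arbitrary \<open>v \<in> C\<close>, summing the inequality bounds the sums of \<open>\<lambda>\<^sub>i f(v, x\<^sup>i)\<close> from above, since
  \<open>f(v, x\<^sup>i) \<le> - f(x\<^sup>i, v)\<close>. By convexity the upper limit of \<open>f(v, z\<^sup>k)\<close> is at most 0. Hence a point in
  which \<open>z\<^sup>k\<close> accumulates weakly satisfies \<open>f(v, z) \<le> 0\<close> for all \<open>v \<in> C\<close>, and Minty's argument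
  (\<open>minty_imp_equilibrium\<close>) turns this into \<open>f(z, v) \<ge> 0\<close>.

  Finally an Opial type argument (\<open>ergodic_opial\<close>) shows that there is only one such accumulation
  point. Weak accumulation is expressed throughout by the closed convex hulls of tails: a closed
  convex condition that holds eventually along a sequence holds on the intersection of these
  hulls (\<open>tail_hull_point_in_closed_convex\<close>), and for a bounded sequence in a Hilbert space that
  intersection is nonempty (\<open>nested_bounded_convex_Inter_nonempty\<close>). If it reduces to one point,
  the sequence converges weakly to it.
\<close>

section \<open>Nested convex sets and weak limits\<close>

text \<open>
  The squared distances from 0 to the sets increase to a limit \<open>D\<close>. By the parallelogram law, the
  points of \<open>K n\<close> whose squared norm is close to \<open>D\<close> form a set of small diameter for large \<open>n\<close>, as their
  midpoints lie in \<open>K n\<close> and cannot have much smaller norm. Completeness then yields a common point.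
  This is how weak compactness of bounded closed convex sets enters the convergence proof.
\<close>

lemma nested_bounded_convex_Inter_nonempty:
  fixes K :: "nat \<Rightarrow> 'a::{real_inner, complete_space} set"
  assumes closed: "\<And>n. closed (K n)" and convex: "\<And>n. convex (K n)"
    and nonempty: "\<And>n. K n \<noteq> {}" and decreasing: "\<And>m n. m \<le> n \<Longrightarrow> K n \<subseteq> K m"
    and bounded: "bounded (K 0)"
  shows "(\<Inter>n. K n) \<noteq> {}"
proof -
  define q where "q n = (INF u\<in>K n. (norm u)\<^sup>2)" for n
  have bdd: "bdd_below ((\<lambda>u. (norm u)\<^sup>2) ` K n)" for n
    by (rule bdd_belowI[of _ 0]) auto
  have q_le: "q n \<le> (norm u)\<^sup>2" if "u \<in> K n" for n u
    unfolding q_def by (rule cINF_lower[OF bdd that])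
  have q_approx: "\<exists>u\<in>K n. (norm u)\<^sup>2 < q n + e" if "e > 0" for n e
    using cINF_less_iff[OF nonempty bdd, of n "q n + e"] that unfolding q_def by auto
  obtain R where R: "\<And>u. u \<in> K 0 \<Longrightarrow> norm u \<le> R"
    using bounded unfolding bounded_iff by blast
  have q_bound: "q n \<le> R\<^sup>2" for n
  proof -
    obtain u where u: "u \<in> K n" using nonempty by blast
    then have "u \<in> K 0" using decreasing[of 0 n] by auto
    with R have "(norm u)\<^sup>2 \<le> R\<^sup>2" by (intro power_mono) auto
    with q_le[OF u] show ?thesis by linarith
  qed
  have "q m \<le> q n" if "m \<le> n" for m n
    unfolding q_def[of n] using decreasing[OF that] by (intro cINF_greatest nonempty q_le) blast
  then have "incseq q" unfolding incseq_def by blast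
  then obtain D where D: "q \<longlonglongrightarrow> D" "\<And>n. q n \<le> D"
    using incseq_convergent[of q "R\<^sup>2"] q_bound by metis
  define B where "B n = K n \<inter> {u. (norm u)\<^sup>2 \<le> D + 1 / real (Suc n)}" for n
  have "\<exists>a. \<forall>n. a \<in> B n"
  proof (rule decreasing_closed_nest[of B])
    show "closed (B n)" for n
      unfolding B_def by (intro closed_Int closed closed_Collect_le continuous_intros)
    show "B n \<noteq> {}" for n
      using q_approx[of "1 / real (Suc n)" n] D(2)[of n] unfolding B_def by fastforce
    show "B n \<subseteq> B m" if "m \<le> n" for m n
    proof -
      have "1 / real (Suc n) \<le> 1 / real (Suc m)"
        using that by (intro divide_left_mono) auto
      then show ?thesis using decreasing[OF that] unfolding B_def by auto
    qed
    show "\<exists>n. \<forall>u\<in>B n. \<forall>v\<in>B n. dist u v < e" if "e > 0" for e :: real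
    proof -
      have "(\<lambda>n. 4 * (D + 1 / real (Suc n)) - 4 * q n) \<longlonglongrightarrow> 4 * (D + 0) - 4 * D"
        by (intro tendsto_intros D(1) LIMSEQ_Suc[OF lim_1_over_n])
      then have "eventually (\<lambda>n. 4 * (D + 1 / real (Suc n)) - 4 * q n < e\<^sup>2) sequentially"
        by (rule order_tendstoD) (use that in auto)
      then obtain n where n: "4 * (D + 1 / real (Suc n)) - 4 * q n < e\<^sup>2"
        unfolding eventually_sequentially by blast
      have "dist u v < e" if uv: "u \<in> B n" "v \<in> B n" for u v
      proof -
        have "(1/2) *\<^sub>R u + (1/2) *\<^sub>R v \<in> K n"
          using uv convex[of n] unfolding B_def convex_def by auto
        then have "q n \<le> (norm ((1/2) *\<^sub>R (u + v)))\<^sup>2"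
          using q_le by (metis scaleR_right_distrib)
        also have "\<dots> = (norm (u + v))\<^sup>2 / 4"
          by (simp add: power2_eq_square)
        finally have "4 * q n \<le> (norm (u + v))\<^sup>2" by simp
        moreover have "(norm (u - v))\<^sup>2 = 2 * (norm u)\<^sup>2 + 2 * (norm v)\<^sup>2 - (norm (u + v))\<^sup>2"
          by (simp add: power2_norm_eq_inner inner_simps inner_commute)
        ultimately have "(norm (u - v))\<^sup>2 < e\<^sup>2"
          using uv n unfolding B_def by simp
        then show ?thesis
          using \<open>e > 0\<close> unfolding dist_norm by (meson less_imp_le power2_less_imp_less)
      qed
      then show ?thesis by blast
    qed
  qed blast
  then show ?thesis unfolding B_def by blast
qed

lemma limitin_weak_topologyI:
  assumes "\<And>\<phi> :: 'a::real_normed_vector \<Rightarrow>\<^sub>L real. (\<lambda>k. blinfun_apply \<phi> (u k)) \<longlonglongrightarrow> blinfun_apply \<phi> z"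
  shows "limitin weak_topology u z sequentially"
proof -
  let ?F = "\<lambda>x (\<phi> :: 'a \<Rightarrow>\<^sub>L real). blinfun_apply \<phi> x"
  have "limitin (product_topology (\<lambda>_. euclidean) UNIV) (\<lambda>k. ?F (u k)) (?F z) sequentially"
    unfolding limitin_componentwise using assms by simp
  then have lim: "limitin euclidean (\<lambda>k. ?F (u k)) (?F z) sequentially"
    by (simp add: euclidean_product_topology)
  show ?thesis
    unfolding limitin_def
  proof (intro conjI allI impI)
    show "z \<in> topspace weak_topology"
      by (simp add: weak_topology_def topspace_pullback_topology)
    fix U assume U: "openin weak_topology U \<and> z \<in> U"
    then obtain V where V: "openin euclidean V" "U = ?F -` V"
      unfolding weak_topology_def openin_pullback_topology by auto
    with U lim have "eventually (\<lambda>k. ?F (u k) \<in> V) sequentially"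
      unfolding limitin_def by auto
    then show "eventually (\<lambda>k. u k \<in> U) sequentially" using V(2) by simp
  qed
qed

lemma openin_weak_topology_imp_open:
  assumes "openin weak_topology (U :: 'a::real_normed_vector set)"
  shows "open U"
proof -
  obtain V where V: "open V" "U = (\<lambda>x (\<phi> :: 'a \<Rightarrow>\<^sub>L real). blinfun_apply \<phi> x) -` V"
    using assms unfolding weak_topology_def openin_pullback_topology by auto
  show ?thesis
    unfolding V(2) by (intro open_vimage V(1) continuous_intros)
qed

section \<open>Weighted averages\<close>

lemma not_summable_imp_partial_sums_at_top:
  fixes l :: "nat \<Rightarrow> real"
  assumes "\<And>k. l k > 0" and "\<not> summable l"
  shows "filterlim (\<lambda>k. \<Sum>i\<le>k. l i) at_top sequentially"
  unfolding filterlim_at_top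
proof
  fix Z
  have "\<exists>n. Z < (\<Sum>i\<le>n. l i)"
    using bounded_imp_summable[of l Z] assms by (meson less_imp_le not_le)
  then obtain n where n: "Z < (\<Sum>i\<le>n. l i)" ..
  have "Z \<le> (\<Sum>i\<le>k. l i)" if "k \<ge> n" for k
    using n sum_mono2[of "{..k}" "{..n}" l] that assms(1) by (simp add: less_imp_le)
  then show "eventually (\<lambda>k. Z \<le> (\<Sum>i\<le>k. l i)) sequentially"
    unfolding eventually_sequentially by blast
qed

text \<open>
  Cesaro's theorem for general weights: a fixed number of initial terms is negligible against the
  divergent sum of the weights.
\<close>

lemma weighted_average_tendsto:
  fixes a l :: "nat \<Rightarrow> real"
  assumes l: "\<And>k. l k > 0" "\<not> summable l" and a: "a \<longlonglongrightarrow> L"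
  shows "(\<lambda>k. (\<Sum>i\<le>k. l i * a i) / (\<Sum>i\<le>k. l i)) \<longlonglongrightarrow> L"
proof (rule LIMSEQ_I)
  fix e :: real assume e: "e > 0"
  obtain N where N: "\<And>i. i \<ge> N \<Longrightarrow> \<bar>a i - L\<bar> < e / 2"
    using LIMSEQ_D[OF a, of "e / 2"] e by auto
  define A where "A = (\<Sum>i<N. l i * \<bar>a i - L\<bar>)"
  have "eventually (\<lambda>k. 2 * A / e + 1 \<le> (\<Sum>i\<le>k. l i)) sequentially"
    using not_summable_imp_partial_sums_at_top[OF l] unfolding filterlim_at_top by blast
  then obtain M where M: "\<And>k. k \<ge> M \<Longrightarrow> 2 * A / e + 1 \<le> (\<Sum>i\<le>k. l i)"
    unfolding eventually_sequentially by blast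
  have "norm ((\<Sum>i\<le>k. l i * a i) / (\<Sum>i\<le>k. l i) - L) < e" if k: "k \<ge> max N M" for k
  proof -
    let ?S = "\<Sum>i\<le>k. l i"
    have S: "?S > 0" using l(1) by (intro sum_pos) auto
    have "\<bar>(\<Sum>i\<le>k. l i * (a i - L))\<bar> \<le> (\<Sum>i\<le>k. \<bar>l i * (a i - L)\<bar>)"
      by (rule sum_abs)
    also have "\<dots> \<le> (\<Sum>i\<le>k. (if i < N then l i * \<bar>a i - L\<bar> else 0) + e / 2 * l i)"
    proof (rule sum_mono)
      fix i
      have "l i * \<bar>a i - L\<bar> \<le> l i * (e / 2)" if "i \<ge> N"
        using N[OF that] l(1)[of i] by (intro mult_left_mono) auto
      then show "\<bar>l i * (a i - L)\<bar> \<le> (if i < N then l i * \<bar>a i - L\<bar> else 0) + e / 2 * l i"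
        using l(1)[of i] e by (auto simp: abs_mult mult.commute)
    qed
    also have "\<dots> = (\<Sum>i\<le>k. if i < N then l i * \<bar>a i - L\<bar> else 0) + e / 2 * ?S"
      by (simp add: sum.distrib sum_distrib_left)
    also have "(\<Sum>i\<le>k. if i < N then l i * \<bar>a i - L\<bar> else 0) = A"
      unfolding A_def using k by (intro sum.mono_neutral_cong_right) auto
    finally have 1: "\<bar>(\<Sum>i\<le>k. l i * (a i - L))\<bar> \<le> A + e / 2 * ?S" .
    have "2 * A / e < ?S" using M[of k] k by simp
    then have "A < e / 2 * ?S" using e by (simp add: field_simps)
    with 1 have 2: "\<bar>(\<Sum>i\<le>k. l i * (a i - L))\<bar> < e * ?S" by simp
    have "(\<Sum>i\<le>k. l i * a i) / ?S - L = (\<Sum>i\<le>k. l i * (a i - L)) / ?S"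
      using S by (simp add: field_simps sum_subtractf sum_distrib_left)
    with 2 S show ?thesis by (simp add: abs_divide field_simps)
  qed
  then show "\<exists>n0. \<forall>k\<ge>n0. norm ((\<Sum>i\<le>k. l i * a i) / (\<Sum>i\<le>k. l i) - L) < e" by blast
qed

lemma ergodic_seq_convex_combination:
  assumes "\<And>k. l k > 0"
  defines "c k i \<equiv> l i / (\<Sum>j\<le>k. l j)"
  shows "ergodic_seq l x k = (\<Sum>i\<le>k. c k i *\<^sub>R x i)"
    and "(\<Sum>i\<le>k. c k i) = 1" and "c k i \<ge> 0"
proof -
  have S: "(\<Sum>j\<le>k. l j) > 0" using assms(1) by (intro sum_pos) auto
  show "ergodic_seq l x k = (\<Sum>i\<le>k. c k i *\<^sub>R x i)"
    unfolding ergodic_seq_def c_def by (simp add: scaleR_sum_right divide_inverse mult.commute)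
  show "(\<Sum>i\<le>k. c k i) = 1"
    using S unfolding c_def by (simp flip: sum_divide_distrib)
  show "c k i \<ge> 0"
    using S assms(1)[of i] unfolding c_def by simp
qed

lemma ergodic_seq_in_convex:
  assumes "\<And>k. l k > 0" "convex D" "\<And>k. x k \<in> D"
  shows "ergodic_seq l x k \<in> D"
  unfolding ergodic_seq_convex_combination[OF assms(1)]
  using assms ergodic_seq_convex_combination[OF assms(1)] by (intro convex_sum) auto

lemma convex_on_ergodic_seq_le:
  assumes "\<And>k. l k > 0" "convex_on D h" "\<And>k. x k \<in> D"
  shows "h (ergodic_seq l x k) \<le> (\<Sum>i\<le>k. l i * h (x i)) / (\<Sum>i\<le>k. l i)"
proof -
  have "h (ergodic_seq l x k) \<le> (\<Sum>i\<le>k. l i / (\<Sum>j\<le>k. l j) * h (x i))"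
    unfolding ergodic_seq_convex_combination(1)[OF assms(1)]
    by (rule convex_on_sum[OF _ _ assms(2)])
      (use assms ergodic_seq_convex_combination[OF assms(1)] in auto)
  then show ?thesis by (simp add: sum_divide_distrib)
qed

lemma inner_ergodic_seq:
  "ergodic_seq l x k \<bullet> w = (\<Sum>i\<le>k. l i * (x i \<bullet> w)) / (\<Sum>i\<le>k. l i)"
  unfolding ergodic_seq_def by (simp add: inner_sum_left divide_inverse mult.commute)

text \<open>
  Points in all closed convex hulls of tails play the role of weak cluster points: a closed convex
  condition passes to them from the sequence.
\<close>

lemma tail_hull_point_in_closed_convex:
  assumes "convex D" "closed D" "eventually (\<lambda>k. z k \<in> D) sequentially"
    and "w \<in> (\<Inter>n. closure (convex hull (z ` {n..})))"
  shows "w \<in> D"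
proof -
  obtain N where "\<And>k. k \<ge> N \<Longrightarrow> z k \<in> D"
    using assms(3) unfolding eventually_sequentially by blast
  then have "closure (convex hull (z ` {N..})) \<subseteq> D"
    using assms(1,2) by (intro closure_minimal hull_minimal) auto
  with assms(4) show ?thesis by blast
qed

text \<open>
  If a functional \<open>\<phi>\<close> does not converge along \<open>z\<close>, then, up to the sign of \<open>\<phi>\<close>, infinitely many terms
  satisfy \<open>\<phi> (z k) \<ge> \<phi> w + e\<close>. The closed convex hulls of the tails of this subsequence have a common
  point, which lies in the closed half-space \<open>\<phi> \<ge> \<phi> w + e\<close> and therefore is a common point of the
  original hulls other than \<open>w\<close>.
\<close>

lemma weak_limit_of_unique_tail_hull_point:
  fixes z :: "nat \<Rightarrow> 'a::{real_inner, complete_space}"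
  assumes bounded: "bounded (range z)"
    and unique: "(\<Inter>n. closure (convex hull (z ` {n..}))) \<subseteq> {w}"
  shows "limitin weak_topology z w sequentially"
proof (rule limitin_weak_topologyI)
  have upper: "eventually (\<lambda>k. blinfun_apply \<phi> (z k) < blinfun_apply \<phi> w + e) sequentially"
    if "e > 0" for \<phi> :: "'a \<Rightarrow>\<^sub>L real" and e
  proof (rule ccontr)
    let ?c = "blinfun_apply \<phi> w + e"
    assume "\<not> ?thesis"
    then have freq: "\<exists>k\<ge>n. ?c \<le> blinfun_apply \<phi> (z k)" for n
      unfolding eventually_sequentially by (meson not_le)
    define A where "A n = z ` {k. n \<le> k \<and> ?c \<le> blinfun_apply \<phi> (z k)}" for n
    have "(\<Inter>n. closure (convex hull (A n))) \<noteq> {}"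
    proof (rule nested_bounded_convex_Inter_nonempty)
      show "closure (convex hull A n) \<noteq> {}" for n
        using freq[of n] unfolding A_def by auto
      show "closure (convex hull A n) \<subseteq> closure (convex hull A m)" if "m \<le> n" for m n
        using that unfolding A_def by (intro closure_mono hull_mono) auto
      show "bounded (closure (convex hull A 0))"
        unfolding A_def
        by (intro bounded_closure bounded_convex_hull bounded_subset[OF bounded]) auto
    qed (auto intro: convex_closure convex_convex_hull)
    then obtain u where u: "\<And>n. u \<in> closure (convex hull (A n))" by blast
    have "closure (convex hull (A n)) \<subseteq> closure (convex hull (z ` {n..}))" for n
      unfolding A_def by (intro closure_mono hull_mono) auto
    with u unique have "u = w" by blast
    have "convex {v. ?c \<le> blinfun_apply \<phi> v}"
      unfolding convex_alt
    proof (safe)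
      fix a b and t :: real
      assume "?c \<le> blinfun_apply \<phi> a" "?c \<le> blinfun_apply \<phi> b" "0 \<le> t" "t \<le> 1"
      then have "(1 - t) * ?c + t * ?c \<le> (1 - t) * blinfun_apply \<phi> a + t * blinfun_apply \<phi> b"
        by (intro add_mono mult_left_mono) auto
      then show "?c \<le> blinfun_apply \<phi> ((1 - t) *\<^sub>R a + t *\<^sub>R b)"
        by (simp add: blinfun.bilinear_simps algebra_simps)
    qed
    moreover have "closed {v. ?c \<le> blinfun_apply \<phi> v}"
      by (intro closed_Collect_le continuous_intros)
    ultimately have "closure (convex hull (A 0)) \<subseteq> {v. ?c \<le> blinfun_apply \<phi> v}"
      unfolding A_def by (intro closure_minimal hull_minimal) auto
    with u[of 0] \<open>u = w\<close> \<open>e > 0\<close> show False by auto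
  qed
  fix \<phi> :: "'a \<Rightarrow>\<^sub>L real"
  show "(\<lambda>k. blinfun_apply \<phi> (z k)) \<longlonglongrightarrow> blinfun_apply \<phi> w"
  proof (rule order_tendstoI)
    fix a assume "a < blinfun_apply \<phi> w"
    then show "eventually (\<lambda>k. a < blinfun_apply \<phi> (z k)) sequentially"
      using upper[of "blinfun_apply \<phi> w - a" "- \<phi>"] by (simp add: blinfun.minus_left)
  next
    fix a assume "blinfun_apply \<phi> w < a"
    then show "eventually (\<lambda>k. blinfun_apply \<phi> (z k) < a) sequentially"
      using upper[of "a - blinfun_apply \<phi> w" \<phi>] by simp
  qed
qed

lemma bounded_if_convergent_dist:
  assumes "convergent (\<lambda>k. (norm (x k - s))\<^sup>2)"
  shows "bounded (range x)"
proof -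
  obtain R where R: "\<And>k. norm ((norm (x k - s))\<^sup>2) \<le> R"
    using convergent_imp_Bseq[OF assms] unfolding Bseq_def by blast
  have "norm (x k - s) \<le> sqrt R" for k
    using R[of k] by (intro real_le_rsqrt) simp
  then show ?thesis
    by (intro bounded_subset[OF bounded_cball[of s "sqrt R"]]) (auto simp: dist_norm norm_minus_commute)
qed

text \<open>
  Passty's ergodic form of Opial's lemma. For \<open>v\<close> and \<open>w\<close> in \<open>S\<close> the difference of the squared
  distances from \<open>x k\<close> to \<open>v\<close> and \<open>w\<close> is affine in \<open>x k\<close>, so \<open>x k \<bullet> (w - v)\<close> converges, and so do its
  weighted averages \<open>z k \<bullet> (w - v)\<close>. The functional is thus constant on the common points of the
  tail hulls; comparing its values at \<open>v\<close> and \<open>w\<close> gives \<open>v = w\<close>.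
\<close>

lemma ergodic_opial:
  fixes x :: "nat \<Rightarrow> 'a::{real_inner, complete_space}"
  assumes l: "\<And>k. l k > 0" "\<not> summable l"
    and "S \<noteq> {}"
    and conv: "\<And>s. s \<in> S \<Longrightarrow> convergent (\<lambda>k. (norm (x k - s))\<^sup>2)"
    and tail: "(\<Inter>n. closure (convex hull (ergodic_seq l x ` {n..}))) \<subseteq> S"
  shows "\<exists>z\<in>S. limitin weak_topology (ergodic_seq l x) z sequentially"
proof -
  let ?z = "ergodic_seq l x"
  let ?K = "\<Inter>n. closure (convex hull (?z ` {n..}))"
  obtain s where "s \<in> S" using \<open>S \<noteq> {}\<close> by blast
  then have "bounded (range x)" by (intro bounded_if_convergent_dist conv)
  then obtain R where "\<And>k. norm (x k) \<le> R" unfolding bounded_iff by auto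
  then have "?z k \<in> cball 0 R" for k
    by (intro ergodic_seq_in_convex l convex_cball) auto
  then have bounded: "bounded (range ?z)"
    by (intro bounded_subset[OF bounded_cball[of 0 R]]) blast
  have "?K \<noteq> {}"
  proof (rule nested_bounded_convex_Inter_nonempty)
    show "closure (convex hull ?z ` {n..}) \<subseteq> closure (convex hull ?z ` {m..})" if "m \<le> n" for m n
      using that by (intro closure_mono hull_mono) auto
    show "bounded (closure (convex hull ?z ` {0..}))"
      by (intro bounded_closure bounded_convex_hull bounded_subset[OF bounded]) auto
  qed (auto intro: convex_closure convex_convex_hull)
  then obtain v where v: "v \<in> ?K" by blast
  have "w = v" if w: "w \<in> ?K" for w
  proof -
    have "v \<in> S" "w \<in> S" using v w tail by blast+
    then obtain a b where "(\<lambda>k. (norm (x k - v))\<^sup>2) \<longlonglongrightarrow> a" "(\<lambda>k. (norm (x k - w))\<^sup>2) \<longlonglongrightarrow> b"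
      using conv unfolding convergent_def by blast
    then have "(\<lambda>k. ((norm (x k - v))\<^sup>2 - (norm (x k - w))\<^sup>2 - v \<bullet> v + w \<bullet> w) / 2)
        \<longlonglongrightarrow> (a - b - v \<bullet> v + w \<bullet> w) / 2"
      by (intro tendsto_intros) auto
    moreover have "((norm (x k - v))\<^sup>2 - (norm (x k - w))\<^sup>2 - v \<bullet> v + w \<bullet> w) / 2 = x k \<bullet> (w - v)" for k
      by (simp add: power2_norm_eq_inner inner_simps inner_commute)
    ultimately obtain L where "(\<lambda>k. x k \<bullet> (w - v)) \<longlonglongrightarrow> L" by auto
    from weighted_average_tendsto[OF l this] have zL: "(\<lambda>k. ?z k \<bullet> (w - v)) \<longlonglongrightarrow> L"
      by (simp add: inner_ergodic_seq)
    have slab: "u \<bullet> (w - v) = L" if u: "u \<in> ?K" for u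
    proof -
      have "\<bar>u \<bullet> (w - v) - L\<bar> \<le> e" if "e > 0" for e
      proof -
        have "u \<in> {p. (w - v) \<bullet> p \<le> L + e} \<inter> {p. (w - v) \<bullet> p \<ge> L - e}"
        proof (rule tail_hull_point_in_closed_convex[OF _ _ _ u])
          show "eventually (\<lambda>k. ?z k \<in> {p. (w - v) \<bullet> p \<le> L + e} \<inter> {p. (w - v) \<bullet> p \<ge> L - e})
              sequentially"
            using tendstoD[OF zL that]
            by eventually_elim (auto simp: dist_real_def inner_commute)
        qed (auto intro: convex_Int convex_halfspace_le convex_halfspace_ge
              closed_Int closed_halfspace_le closed_halfspace_ge)
        then show ?thesis by (auto simp: inner_commute abs_le_iff)
      qed
      then have "\<bar>u \<bullet> (w - v) - L\<bar> \<le> 0"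
        by (metis add_0 field_le_epsilon)
      then show ?thesis by simp
    qed
    have "(w - v) \<bullet> (w - v) = 0"
      using slab[OF v] slab[OF w] by (simp add: inner_diff_left)
    then show ?thesis by simp
  qed
  then have "limitin weak_topology ?z v sequentially"
    by (intro weak_limit_of_unique_tail_hull_point bounded) blast
  with v tail show ?thesis by blast
qed

section \<open>Proximal steps\<close>

text \<open>
  The first-order optimality condition, tested only in the direction \<open>v - u\<close>: minimality along the
  segment from \<open>u\<close> to \<open>v\<close> and convexity of \<open>h\<close> make the one-sided derivative at \<open>u\<close> nonnegative, and
  the polarisation identity rewrites this in terms of squared distances.
\<close>

lemma prox_inequality:
  fixes c :: "'a::real_inner"
  assumes h: "convex_on C h" and u: "u \<in> C" and v: "v \<in> C" and l: "l \<ge> 0"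
    and min: "\<And>v. v \<in> C \<Longrightarrow> l * h u + 1 / 2 * (norm (u - c))\<^sup>2 \<le> l * h v + 1 / 2 * (norm (v - c))\<^sup>2"
  shows "(norm (u - v))\<^sup>2 \<le> (norm (c - v))\<^sup>2 - (norm (c - u))\<^sup>2 + 2 * l * (h v - h u)"
proof -
  define d where "d = l * (h v - h u) + (u - c) \<bullet> (v - u)"
  have "0 \<le> d + t * (norm (v - u))\<^sup>2 / 2" if t: "0 < t" "t \<le> 1" for t
  proof -
    let ?w = "(1 - t) *\<^sub>R u + t *\<^sub>R v"
    have w: "?w \<in> C" "h ?w \<le> (1 - t) * h u + t * h v"
      using h u v t unfolding convex_on_def convex_alt by auto
    have "?w - c = (u - c) + t *\<^sub>R (v - u)" by (simp add: algebra_simps)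
    then have "(norm (?w - c))\<^sup>2
        = (norm (u - c))\<^sup>2 + 2 * t * ((u - c) \<bullet> (v - u)) + t\<^sup>2 * (norm (v - u))\<^sup>2"
      unfolding power2_norm_eq_inner by (simp add: inner_simps inner_commute power2_eq_square algebra_simps)
    moreover have "l * h ?w \<le> l * ((1 - t) * h u + t * h v)"
      using w(2) l by (rule mult_left_mono)
    ultimately have "0 \<le> t * (d + t * (norm (v - u))\<^sup>2 / 2)"
      using min[OF w(1)] unfolding d_def by (simp add: algebra_simps power2_eq_square)
    with t show ?thesis by (simp add: zero_le_mult_iff)
  qed
  then have "eventually (\<lambda>t. 0 \<le> d + t * (norm (v - u))\<^sup>2 / 2) (at_right 0)"
    unfolding eventually_at_right_field by (intro exI[of _ 1]) auto
  moreover have "((\<lambda>t. d + t * (norm (v - u))\<^sup>2 / 2) \<longlongrightarrow> d + 0 * (norm (v - u))\<^sup>2 / 2) (at_right 0)"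
    by (intro tendsto_intros) auto
  ultimately have "0 \<le> d" using tendsto_lowerbound by fastforce
  then show ?thesis
    unfolding d_def power2_norm_eq_inner by (simp add: inner_simps inner_commute algebra_simps)
qed

text \<open>
  The two proximal inequalities leave the terms \<open>- l * h1 y\<close> and \<open>- l * h2 x'\<close>, which the
  subgradients at \<open>x\<close> bound by \<open>b\<close> times the distances travelled. The negative squares
  \<open>- \<parallel>x - y\<parallel>\<^sup>2\<close> and \<open>- \<parallel>y - x'\<parallel>\<^sup>2\<close> absorb these distances up to a multiple of \<open>b\<^sup>2\<close>.
\<close>

lemma splitting_step_inequality:
  fixes x :: "'a::real_inner"
  assumes h: "convex_on C h1" "convex_on C h2" "h1 x = 0" "h2 x = 0"
    and mem: "y \<in> C" "x' \<in> C" "v \<in> C" and l: "l \<ge> 0"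
    and y: "\<And>v. v \<in> C \<Longrightarrow> l * h1 y + 1 / 2 * (norm (y - x))\<^sup>2 \<le> l * h1 v + 1 / 2 * (norm (v - x))\<^sup>2"
    and x': "\<And>v. v \<in> C \<Longrightarrow> l * h2 x' + 1 / 2 * (norm (x' - y))\<^sup>2 \<le> l * h2 v + 1 / 2 * (norm (v - y))\<^sup>2"
    and g1: "\<And>v. v \<in> C \<Longrightarrow> g1 \<bullet> (v - x) \<le> h1 v" "l * norm g1 \<le> b"
    and g2: "\<And>v. v \<in> C \<Longrightarrow> g2 \<bullet> (v - x) \<le> h2 v" "l * norm g2 \<le> b"
  shows "(norm (x' - v))\<^sup>2 \<le> (norm (x - v))\<^sup>2 + 2 * l * (h1 v + h2 v) + 5 * b\<^sup>2"
proof -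
  have lower: "- (b * norm (w - x)) \<le> l * h w"
    if "w \<in> C" "\<And>v. v \<in> C \<Longrightarrow> g \<bullet> (v - x) \<le> h v" "l * norm g \<le> b" for g w h
  proof -
    have "- (norm g * norm (w - x)) \<le> h w"
      using Cauchy_Schwarz_ineq2[of g "w - x"] that(2)[OF that(1)] by linarith
    then have "l * - (norm g * norm (w - x)) \<le> l * h w"
      using l by (rule mult_left_mono)
    moreover have "l * norm g * norm (w - x) \<le> b * norm (w - x)"
      using that(3) by (rule mult_right_mono) auto
    ultimately show ?thesis by (simp add: mult.assoc)
  qed
  define p q where "p = norm (x - y)" and "q = norm (y - x')"
  have b: "b \<ge> 0" using g1(2) l by (meson mult_nonneg_nonneg norm_ge_zero order_trans)
  have "norm (x' - x) \<le> p + q"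
    unfolding p_def q_def
    using norm_triangle_ineq[of "x - y" "y - x'"] by (simp add: norm_minus_commute)
  then have "b * norm (x' - x) \<le> b * (p + q)" using b by (rule mult_left_mono)
  then have 2: "- (b * (p + q)) \<le> l * h2 x'"
    using lower[OF mem(2) g2] by linarith
  have 1: "- (b * p) \<le> l * h1 y"
    using lower[OF mem(1) g1] unfolding p_def by (simp add: norm_minus_commute)
  have "(norm (y - v))\<^sup>2 \<le> (norm (x - v))\<^sup>2 - p\<^sup>2 + 2 * l * (h1 v - h1 y)"
    unfolding p_def by (rule prox_inequality[OF h(1) mem(1,3) l y])
  moreover have "(norm (x' - v))\<^sup>2 \<le> (norm (y - v))\<^sup>2 - q\<^sup>2 + 2 * l * (h2 v - h2 x')"
    unfolding q_def by (rule prox_inequality[OF h(2) mem(2,3) l x'])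
  \<comment> \<open>The total error is \<open>4 b p - p\<^sup>2 + 2 b q - q\<^sup>2\<close>; completing both squares bounds it by
      \<open>4 b\<^sup>2 + b\<^sup>2\<close>.\<close>
  moreover have "0 \<le> (p - 2 * b)\<^sup>2" "0 \<le> (q - b)\<^sup>2" by simp_all
  ultimately show ?thesis
    using 1 2 by (simp add: algebra_simps power2_eq_square)
qed

text \<open>
  Subtracting the partial sums of the errors makes the sequence decreasing.
\<close>

lemma quasi_monotone_convergent:
  fixes a e :: "nat \<Rightarrow> real"
  assumes a: "\<And>k. a k \<ge> 0" "\<And>k. a (Suc k) \<le> a k + e k" and e: "summable e" "\<And>k. e k \<ge> 0"
  shows "convergent a"
proof -
  let ?b = "\<lambda>k. a k - (\<Sum>i<k. e i)"
  have "decseq ?b" using a(2) by (intro decseq_SucI) (simp add: algebra_simps)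
  moreover have "\<forall>k. - suminf e \<le> ?b k"
  proof
    fix k
    have "(\<Sum>i<k. e i) \<le> suminf e" by (intro sum_le_suminf e) auto
    with a(1)[of k] show "- suminf e \<le> ?b k" by linarith
  qed
  ultimately obtain L where "?b \<longlonglongrightarrow> L" using decseq_convergent by blast
  then have "(\<lambda>k. ?b k + (\<Sum>i<k. e i)) \<longlonglongrightarrow> L + suminf e"
    by (intro tendsto_add summable_LIMSEQ e)
  then show ?thesis unfolding convergent_def by auto
qed

section \<open>Bifunctions with extended values\<close>

lemma convex_on_real_of_ereal:
  assumes h: "ereal_convex h" and C: "convex C" and finite: "\<And>v. v \<in> C \<Longrightarrow> \<bar>h v\<bar> \<noteq> \<infinity>"
  shows "convex_on C (\<lambda>v. real_of_ereal (h v))"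
  unfolding convex_on_def
proof (intro conjI C ballI allI impI)
  have real: "ereal (real_of_ereal (h v)) = h v" if "v \<in> C" for v
    using finite[OF that] by (rule ereal_real')
  fix v w :: 'a and s t :: real
  assume *: "v \<in> C" "w \<in> C" "0 \<le> s" "0 \<le> t" "s + t = 1"
  then have mem: "s *\<^sub>R v + t *\<^sub>R w \<in> C" using C unfolding convex_def by blast
  have s: "s = 1 - t" "t \<in> {0..1}" using * by auto
  have "h (s *\<^sub>R v + t *\<^sub>R w) \<le> ereal s * h v + ereal t * h w"
    using h s unfolding ereal_convex_def by blast
  then have "ereal (real_of_ereal (h (s *\<^sub>R v + t *\<^sub>R w)))
      \<le> ereal s * ereal (real_of_ereal (h v)) + ereal t * ereal (real_of_ereal (h w))"
    by (simp only: real mem *)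
  then show "real_of_ereal (h (s *\<^sub>R v + t *\<^sub>R w))
      \<le> s * real_of_ereal (h v) + t * real_of_ereal (h w)"
    by simp
qed

text \<open>
  A subgradient at the limit point is a continuous affine minorant that is exact there, which gives
  lower semicontinuity.
\<close>

lemma closed_sublevel_if_subdifferentiable:
  fixes h :: "'a::real_inner \<Rightarrow> real"
  assumes "closed C" and sub: "\<And>u. u \<in> C \<Longrightarrow> \<exists>g. \<forall>w\<in>C. h u + g \<bullet> (w - u) \<le> h w"
  shows "closed {u \<in> C. h u \<le> e}"
  unfolding closed_sequential_limits
proof (intro allI impI, elim conjE)
  fix s u assume s: "\<forall>n. s n \<in> {u \<in> C. h u \<le> e}" and lim: "s \<longlonglongrightarrow> u"
  then have u: "u \<in> C" using \<open>closed C\<close> unfolding closed_sequential_limits by blast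
  then obtain g where g: "\<And>w. w \<in> C \<Longrightarrow> h u + g \<bullet> (w - u) \<le> h w" using sub by blast
  have "(\<lambda>n. h u + g \<bullet> (s n - u)) \<longlonglongrightarrow> h u + g \<bullet> (u - u)"
    by (intro tendsto_intros lim)
  moreover have "h u + g \<bullet> (s n - u) \<le> e" for n
    using g[of "s n"] spec[OF s, of n] by simp
  ultimately have "h u + g \<bullet> (u - u) \<le> e" by (intro LIMSEQ_le_const2) auto
  with u show "u \<in> {u \<in> C. h u \<le> e}" by simp
qed

lemma convex_sublevel:
  assumes "convex_on C h"
  shows "convex {u \<in> C. h u \<le> e}"
  unfolding convex_def
proof (intro ballI allI impI)
  fix v w and s t :: real
  assume *: "v \<in> {u \<in> C. h u \<le> e}" "w \<in> {u \<in> C. h u \<le> e}" "0 \<le> s" "0 \<le> t" "s + t = 1"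
  have "h (s *\<^sub>R v + t *\<^sub>R w) \<le> s * h v + t * h w" "s *\<^sub>R v + t *\<^sub>R w \<in> C"
    using assms * unfolding convex_on_def convex_def by auto
  moreover have "s * h v + t * h w \<le> e"
    using * by (intro convex_bound_le) auto
  ultimately show "s *\<^sub>R v + t *\<^sub>R w \<in> {u \<in> C. h u \<le> e}" by simp
qed

text \<open>
  For a point \<open>p\<close> strictly between \<open>z\<close> and \<open>v\<close>, convexity writes \<open>0 = F p p\<close> as at most a combination
  of \<open>F p z \<le> 0\<close> and \<open>F p v\<close>, so \<open>F p v \<ge> 0\<close>. Upper semicontinuity passes this to \<open>z\<close> as \<open>p\<close>
  approaches \<open>z\<close> in norm, hence weakly.
\<close>

lemma minty_imp_equilibrium:
  fixes F :: "'a::real_normed_vector \<Rightarrow> 'a \<Rightarrow> real"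
  assumes "convex C" and F: "\<And>u. u \<in> C \<Longrightarrow> convex_on C (F u)" "\<And>u. u \<in> C \<Longrightarrow> F u u = 0"
    and usc: "\<And>v. v \<in> C \<Longrightarrow> weakly_usc_on C (\<lambda>u. ereal (F u v))"
    and z: "z \<in> C" "\<And>v. v \<in> C \<Longrightarrow> F v z \<le> 0" and v: "v \<in> C"
  shows "F z v \<ge> 0"
proof (rule ccontr)
  assume neg: "\<not> F z v \<ge> 0"
  define p where "p t = (1 - t) *\<^sub>R z + t *\<^sub>R v" for t :: real
  have nonneg: "p t \<in> C \<and> F (p t) v \<ge> 0" if t: "0 < t" "t < 1" for t
  proof -
    have p: "p t \<in> C" unfolding p_def using \<open>convex C\<close> z v t by (auto simp: convex_alt)
    have "F (p t) (p t) \<le> (1 - t) * F (p t) z + t * F (p t) v"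
      using F(1)[OF p] z(1) v t unfolding convex_on_def p_def by auto
    moreover have "(1 - t) * F (p t) z \<le> 0"
      using z(2)[OF p] t by (simp add: mult_nonneg_nonpos)
    ultimately have "0 \<le> t * F (p t) v" using F(2)[OF p] by simp
    with t p show ?thesis by (simp add: zero_le_mult_iff)
  qed
  obtain U where U: "openin weak_topology U" "{u \<in> C. ereal (F u v) < 0} = U \<inter> C"
    using usc[OF v] unfolding weakly_usc_on_def openin_subtopology by meson
  have "z \<in> {u \<in> C. ereal (F u v) < 0}" using neg z(1) by simp
  then have "z \<in> U" unfolding U(2) by blast
  have "(p \<longlongrightarrow> (1 - 0) *\<^sub>R z + 0 *\<^sub>R v) (at_right 0)"
    unfolding p_def by (intro tendsto_intros)
  then have "eventually (\<lambda>t. p t \<in> U) (at_right 0)"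
    using topological_tendstoD[OF _ openin_weak_topology_imp_open[OF U(1)]] \<open>z \<in> U\<close> by auto
  then obtain d where d: "d > 0" "\<And>t. 0 < t \<Longrightarrow> t < d \<Longrightarrow> p t \<in> U"
    unfolding eventually_at_right_field by blast
  define t where "t = min d 1 / 2"
  have t: "0 < t" "t < d" "t < 1" using d(1) unfolding t_def by auto
  have "p t \<in> {u \<in> C. ereal (F u v) < 0}" unfolding U(2) using d(2)[of t] nonneg[of t] t by simp
  with nonneg[of t] t show False by auto
qed

lemma step_size_bounds:
  fixes g1 g2 :: "'a::real_inner"
  assumes "b > 0"
  shows "step_size b g1 g2 > 0" "step_size b g1 g2 * norm g1 \<le> b" "step_size b g1 g2 * norm g2 \<le> b"
    and "\<lbrakk>b \<le> M; norm g1 \<le> M; norm g2 \<le> M\<rbrakk> \<Longrightarrow> b / M \<le> step_size b g1 g2"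
proof -
  define m where "m = max b (max (norm g1) (norm g2))"
  have m: "m > 0" "norm g1 \<le> m" "norm g2 \<le> m" using assms unfolding m_def by auto
  have eq: "step_size b g1 g2 = b / m" unfolding step_size_def m_def ..
  show "step_size b g1 g2 > 0" unfolding eq using assms m by simp
  show "step_size b g1 g2 * norm g1 \<le> b" "step_size b g1 g2 * norm g2 \<le> b"
    unfolding eq using assms m by (simp_all add: field_simps)
  show "b / M \<le> step_size b g1 g2" if "b \<le> M" "norm g1 \<le> M" "norm g2 \<le> M"
    unfolding eq using that assms m by (intro divide_left_mono) (auto simp: m_def)
qed

lemma prox_step_real:
  assumes prox: "prox_step C l h c u" and finite: "\<And>v. v \<in> C \<Longrightarrow> \<bar>h v\<bar> \<noteq> \<infinity>"
  shows "u \<in> C"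
    and "v \<in> C \<Longrightarrow> l * real_of_ereal (h u) + 1 / 2 * (norm (u - c))\<^sup>2
      \<le> l * real_of_ereal (h v) + 1 / 2 * (norm (v - c))\<^sup>2"
proof -
  show u: "u \<in> C" using prox unfolding prox_step_def is_arg_min_linorder by simp
  have real: "ereal (real_of_ereal (h v)) = h v" if "v \<in> C" for v
    using finite[OF that] by (rule ereal_real')
  assume v: "v \<in> C"
  have "ereal l * h u + ereal (1 / 2 * (norm (u - c))\<^sup>2) \<le> ereal l * h v + ereal (1 / 2 * (norm (v - c))\<^sup>2)"
    using prox v unfolding prox_step_def is_arg_min_linorder by simp
  then have "ereal l * ereal (real_of_ereal (h u)) + ereal (1 / 2 * (norm (u - c))\<^sup>2)
      \<le> ereal l * ereal (real_of_ereal (h v)) + ereal (1 / 2 * (norm (v - c))\<^sup>2)"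
    by (simp only: real u v)
  then show "l * real_of_ereal (h u) + 1 / 2 * (norm (u - c))\<^sup>2
      \<le> l * real_of_ereal (h v) + 1 / 2 * (norm (v - c))\<^sup>2"
    by simp
qed

lemma subdifferential_real:
  assumes g: "g \<in> subdifferential h u" and finite: "\<And>v. v \<in> C \<Longrightarrow> \<bar>h v\<bar> \<noteq> \<infinity>"
    and "u \<in> C" "v \<in> C"
  shows "real_of_ereal (h u) + g \<bullet> (v - u) \<le> real_of_ereal (h v)"
proof -
  have "h u + ereal (g \<bullet> (v - u)) \<le> h v" using g unfolding subdifferential_def by blast
  then have "ereal (real_of_ereal (h u)) + ereal (g \<bullet> (v - u)) \<le> ereal (real_of_ereal (h v))"
    by (simp only: ereal_real'[OF finite] assms(3,4))
  then show ?thesis by simp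
qed

section \<open>Convergence of the splitting method\<close>

theorem theorem2:
  fixes C :: "'a::{real_inner, complete_space} set"
    and f1 f2 f :: "'a \<Rightarrow> 'a \<Rightarrow> ereal"
    and \<beta> l :: "nat \<Rightarrow> real"
    and x y g1 g2 :: "nat \<Rightarrow> 'a"
  assumes C: "C \<noteq> {}" "closed C" "convex C"
    and f: "\<And>u v. f u v = f1 u v + f2 u v"
    and not_minus_infinity: "\<And>u v. f1 u v \<noteq> -\<infinity>" "\<And>u v. f2 u v \<noteq> -\<infinity>"
    and finite_on_C: "\<And>u v. u \<in> C \<Longrightarrow> v \<in> C \<Longrightarrow> f1 u v \<noteq> \<infinity>"
      "\<And>u v. u \<in> C \<Longrightarrow> v \<in> C \<Longrightarrow> f2 u v \<noteq> \<infinity>"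
    and diagonal: "\<And>u. u \<in> C \<Longrightarrow> f1 u u = 0" "\<And>u. u \<in> C \<Longrightarrow> f2 u u = 0"
    and solvable: "EP_solutions C f \<noteq> {}"
    and A1_convex: "\<And>u. u \<in> C \<Longrightarrow> ereal_convex (f1 u)" "\<And>u. u \<in> C \<Longrightarrow> ereal_convex (f2 u)"
    and A1_subdiff: "\<And>u. u \<in> C \<Longrightarrow> subdifferentiable_on C (f1 u)"
      "\<And>u. u \<in> C \<Longrightarrow> subdifferentiable_on C (f2 u)"
    and A1_usc: "\<And>v. v \<in> C \<Longrightarrow> weakly_usc_on C (\<lambda>u. f u v)"
    and A2: "diag_subdifferential_bounded_on C f1" "diag_subdifferential_bounded_on C f2"
    and A3: "monotone_bifunction_on C f"
    and qualification: "interior C \<noteq> {} \<or>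
      (\<forall>u\<in>C. (\<exists>v\<in>C. isCont (f1 u) v) \<and> (\<exists>v\<in>C. isCont (f2 u) v))"
    and \<beta>: "\<And>k. \<beta> k > 0" "\<not> summable \<beta>" "summable (\<lambda>k. (\<beta> k)\<^sup>2)"
    and iteration: "splitting_iteration C f1 f2 \<beta> x y g1 g2 l"
  shows "\<exists>z \<in> EP_solutions C f. limitin weak_topology (ergodic_seq l x) z sequentially"
proof -
  define F1 F2 F where "F1 u v = real_of_ereal (f1 u v)" and "F2 u v = real_of_ereal (f2 u v)"
    and "F u v = F1 u v + F2 u v" for u v
  have fin1: "\<bar>f1 u v\<bar> \<noteq> \<infinity>" and fin2: "\<bar>f2 u v\<bar> \<noteq> \<infinity>" if "u \<in> C" "v \<in> C" for u v
    using finite_on_C[OF that] not_minus_infinity[of u v] by auto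
  have f_eq: "f u v = ereal (F u v)" if "u \<in> C" "v \<in> C" for u v
    using fin1[OF that] fin2[OF that] unfolding f F_def F1_def F2_def
    by (simp add: ereal_real' flip: plus_ereal.simps(1))
  have cvx1: "convex_on C (F1 u)" and cvx2: "convex_on C (F2 u)" if "u \<in> C" for u
    unfolding F1_def F2_def
    using convex_on_real_of_ereal[OF A1_convex(1)[OF that] C(3) fin1[OF that]]
      convex_on_real_of_ereal[OF A1_convex(2)[OF that] C(3) fin2[OF that]] by blast+
  have cvx: "convex_on C (F u)" if "u \<in> C" for u
    unfolding F_def using cvx1[OF that] cvx2[OF that] by (rule convex_on_add)
  have diag: "F1 u u = 0" "F2 u u = 0" "F u u = 0" if "u \<in> C" for u
    using diagonal[OF that] unfolding F_def F1_def F2_def by simp_all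
  have mono: "F u v + F v u \<le> 0" if "u \<in> C" "v \<in> C" for u v
    using A3 that f_eq unfolding monotone_bifunction_on_def by fastforce
  have sol: "EP_solutions C f = {u \<in> C. \<forall>v\<in>C. 0 \<le> F u v}"
    unfolding EP_solutions_def using f_eq by auto
  have usc: "weakly_usc_on C (\<lambda>u. ereal (F u v))" if "v \<in> C" for v
  proof -
    have "{u \<in> C. ereal (F u v) < a} = {u \<in> C. f u v < a}" for a
      using f_eq[OF _ that] by auto
    with A1_usc[OF that] show ?thesis unfolding weakly_usc_on_def by simp
  qed
  have sub: "\<exists>g. \<forall>w\<in>C. F v u + g \<bullet> (w - u) \<le> F v w" if v: "v \<in> C" and u: "u \<in> C" for u v
  proof -
    obtain h1 h2 where "h1 \<in> subdifferential (f1 v) u" "h2 \<in> subdifferential (f2 v) u"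
      using A1_subdiff[OF v] u unfolding subdifferentiable_on_def by blast
    then have "F1 v u + h1 \<bullet> (w - u) \<le> F1 v w" "F2 v u + h2 \<bullet> (w - u) \<le> F2 v w" if "w \<in> C" for w
      unfolding F1_def F2_def
      using subdifferential_real[of h1 "f1 v" u C w] subdifferential_real[of h2 "f2 v" u C w]
        fin1[OF v] fin2[OF v] u that by blast+
    then show ?thesis
      unfolding F_def by (intro exI[of _ "h1 + h2"]) (fastforce simp: inner_add_left)
  qed

  have it: "g1 k \<in> diag_subdifferential f1 (x k)" "g2 k \<in> diag_subdifferential f2 (x k)"
    "l k = step_size (\<beta> k) (g1 k) (g2 k)"
    "prox_step C (l k) (f1 (x k)) (x k) (y k)" "prox_step C (l k) (f2 (x k)) (y k) (x (Suc k))" for k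
    using iteration unfolding splitting_iteration_def by blast+
  have xC: "x k \<in> C" for k
    using iteration it(5) unfolding splitting_iteration_def prox_step_def is_arg_min_def
    by (cases k) auto
  have yC: "y k \<in> C" for k
    using it(4) unfolding prox_step_def is_arg_min_def by blast
  have lpos: "l k > 0" for k
    unfolding it(3) using \<beta>(1) by (rule step_size_bounds)

  have descent: "(norm (x (Suc k) - v))\<^sup>2 \<le> (norm (x k - v))\<^sup>2 + 2 * l k * F (x k) v + 5 * (\<beta> k)\<^sup>2"
    if v: "v \<in> C" for k v
    unfolding F_def
  proof (rule splitting_step_inequality[OF cvx1[OF xC] cvx2[OF xC] diag(1)[OF xC] diag(2)[OF xC] yC xC v])
    show "0 \<le> l k" using lpos[of k] by simp
    show "l k * norm (g1 k) \<le> \<beta> k" "l k * norm (g2 k) \<le> \<beta> k"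
      unfolding it(3) using \<beta>(1) by (rule step_size_bounds)+
    fix w assume w: "w \<in> C"
    show "l k * F1 (x k) (y k) + 1 / 2 * (norm (y k - x k))\<^sup>2
        \<le> l k * F1 (x k) w + 1 / 2 * (norm (w - x k))\<^sup>2"
      unfolding F1_def by (rule prox_step_real(2)[OF it(4) fin1[OF xC] w])
    show "l k * F2 (x k) (x (Suc k)) + 1 / 2 * (norm (x (Suc k) - y k))\<^sup>2
        \<le> l k * F2 (x k) w + 1 / 2 * (norm (w - y k))\<^sup>2"
      unfolding F2_def by (rule prox_step_real(2)[OF it(5) fin2[OF xC] w])
    show "g1 k \<bullet> (w - x k) \<le> F1 (x k) w" 
      using subdifferential_real[OF it(1)[unfolded diag_subdifferential_def] fin1[OF xC] xC w]
        diag(1)[OF xC] unfolding F1_def by simp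
    show "g2 k \<bullet> (w - x k) \<le> F2 (x k) w" 
      using subdifferential_real[OF it(2)[unfolded diag_subdifferential_def] fin2[OF xC] xC w]
        diag(2)[OF xC] unfolding F2_def by simp
  qed

  have summ: "summable (\<lambda>k. 5 * (\<beta> k)\<^sup>2)" by (intro summable_mult \<beta>(3))
  \<comment> \<open>If \<open>s\<close> is a solution, monotonicity makes the term with \<open>F (x k) s\<close> in the descent inequality
      nonpositive.\<close>
  have dist_conv: "convergent (\<lambda>k. (norm (x k - s))\<^sup>2)" if s: "s \<in> EP_solutions C f" for s
  proof (rule quasi_monotone_convergent[OF _ _ summ])
    fix k
    have sC: "s \<in> C" and "0 \<le> F s (x k)" using s xC unfolding sol by auto
    then have "F (x k) s \<le> 0" using mono[OF xC sC, of k] by linarith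
    then have "2 * l k * F (x k) s \<le> 0" using lpos[of k] by (simp add: mult_nonneg_nonpos)
    with descent[OF sC, of k]
    show "(norm (x (Suc k) - s))\<^sup>2 \<le> (norm (x k - s))\<^sup>2 + 5 * (\<beta> k)\<^sup>2" by linarith
  qed auto

  have x_bounded: "bounded (range x)"
    using solvable bounded_if_convergent_dist[OF dist_conv] by blast
  have l_div: "\<not> summable l"
  proof
    assume "summable l"
    have "bounded (range g1)" "bounded (range g2)"
      using A2 x_bounded it(1,2) xC unfolding diag_subdifferential_bounded_on_def by blast+
    then obtain M1 M2 where M: "\<And>k. norm (g1 k) \<le> M1" "\<And>k. norm (g2 k) \<le> M2"
      unfolding bounded_iff by auto
    have "(\<lambda>k. sqrt ((\<beta> k)\<^sup>2)) \<longlonglongrightarrow> sqrt 0"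
      by (intro tendsto_real_sqrt summable_LIMSEQ_zero \<beta>(3))
    then have "convergent \<beta>" using \<beta>(1) by (auto simp: convergent_def less_imp_le)
    then obtain M3 where "\<And>k. norm (\<beta> k) \<le> M3"
      using convergent_imp_Bseq[of \<beta>] unfolding Bseq_def by blast
    then have M3: "\<beta> k \<le> M3" for k using abs_le_D1[of "\<beta> k" M3] by simp
    define M where "M = max M3 (max M1 M2)"
    have M0: "M > 0" using \<beta>(1)[of 0] M3[of 0] unfolding M_def by linarith
    have "\<beta> k / M \<le> l k" for k
      unfolding it(3)
      by (rule step_size_bounds(4)[OF \<beta>(1)]) (use M[of k] M3[of k] in \<open>auto simp: M_def\<close>)
    then have "summable (\<lambda>k. \<beta> k / M)"
      using \<beta>(1) M0 by (intro summable_comparison_test'[OF \<open>summable l\<close>, of 0]) (simp add: less_imp_le)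
    then have "summable (\<lambda>k. \<beta> k / M * M)" by (rule summable_mult2)
    with \<beta>(2) M0 show False by simp
  qed

  let ?z = "ergodic_seq l x"
  \<comment> \<open>Against an arbitrary point of \<open>C\<close> the telescoped inequality controls the averages of
      \<open>F v (x i)\<close>, because the sum of the weights diverges.\<close>
  have gap: "eventually (\<lambda>k. F v (?z k) \<le> e) sequentially" if v: "v \<in> C" and "e > 0" for v e
  proof -
    define B where "B = (norm (x 0 - v))\<^sup>2 + (\<Sum>k. 5 * (\<beta> k)\<^sup>2)"
    have partial: "(\<Sum>i<n. 2 * (l i * F v (x i))) \<le> (norm (x 0 - v))\<^sup>2 - (norm (x n - v))\<^sup>2
        + (\<Sum>i<n. 5 * (\<beta> i)\<^sup>2)" for n
    proof (induction n)
      case (Suc n)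
      have "l n * F v (x n) \<le> l n * - F (x n) v"
        using mono[OF xC v, of n] lpos[of n] by (intro mult_left_mono) auto
      with Suc descent[OF v, of n] show ?case by simp
    qed simp
    have upper: "(\<Sum>i\<le>k. l i * F v (x i)) \<le> B / 2" for k
    proof -
      have "(\<Sum>i<Suc k. 5 * (\<beta> i)\<^sup>2) \<le> (\<Sum>k. 5 * (\<beta> k)\<^sup>2)"
        by (intro sum_le_suminf summ) auto
      with partial[of "Suc k"] have "(\<Sum>i<Suc k. 2 * (l i * F v (x i))) \<le> B"
        unfolding B_def using zero_le_power2[of "norm (x (Suc k) - v)"] by linarith
      then show ?thesis
        by (simp add: lessThan_Suc_atMost flip: sum_distrib_left)
    qed
    have "eventually (\<lambda>k. max 1 (B / 2 / e) \<le> (\<Sum>i\<le>k. l i)) sequentially"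
      using not_summable_imp_partial_sums_at_top[OF lpos l_div] unfolding filterlim_at_top by blast
    then show ?thesis
    proof eventually_elim
      case (elim k)
      have "F v (?z k) \<le> (\<Sum>i\<le>k. l i * F v (x i)) / (\<Sum>i\<le>k. l i)"
        by (rule convex_on_ergodic_seq_le[OF lpos cvx[OF v] xC])
      also have "\<dots> \<le> e"
        using elim upper[of k] \<open>e > 0\<close> by (simp add: field_simps)
      finally show ?case .
    qed
  qed

  have tail: "(\<Inter>n. closure (convex hull (?z ` {n..}))) \<subseteq> EP_solutions C f"
  proof
    fix w assume w: "w \<in> (\<Inter>n. closure (convex hull (?z ` {n..})))"
    have zC: "?z k \<in> C" for k by (rule ergodic_seq_in_convex[OF lpos C(3) xC])
    have sublevel: "w \<in> {u \<in> C. F v u \<le> e}" if v: "v \<in> C" and "e > 0" for v e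
    proof (rule tail_hull_point_in_closed_convex[OF _ _ _ w])
      show "convex {u \<in> C. F v u \<le> e}"
        using cvx[OF v] by (rule convex_sublevel)
      show "closed {u \<in> C. F v u \<le> e}"
        using C(2) sub[OF v] by (rule closed_sublevel_if_subdifferentiable)
      show "eventually (\<lambda>k. ?z k \<in> {u \<in> C. F v u \<le> e}) sequentially"
        using gap[OF that] by eventually_elim (simp add: zC)
    qed
    then have wC: "w \<in> C" using C(1) zero_less_one by blast
    have "F v w \<le> 0" if "v \<in> C" for v
    proof (rule field_le_epsilon)
      fix e :: real assume "e > 0"
      then show "F v w \<le> 0 + e" using sublevel[OF that] by simp
    qed
    then have "\<forall>v\<in>C. 0 \<le> F w v"
      using minty_imp_equilibrium[OF C(3) cvx diag(3) usc wC] by blast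
    with wC show "w \<in> EP_solutions C f" unfolding sol by simp
  qed
  show ?thesis
    by (rule ergodic_opial[OF lpos l_div solvable dist_conv tail])
qed

end
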